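(* For every pair $a,b$ of integers with $2\leq a\leq b$, there exists a connected graph $G$ such that $spvc(G)=a$ and $srvc(G)=b$.
   Context: All graphs are simple, finite and undirected. Vertex-colorings are arbitrary (adjacent vertices may receive the same color). A path in a vertex-colored graph is a vertex-proper path if any two adjacent internal vertices of the path differ in color, and a vertex-rainbow path if all its internal vertices have pairwise different colors (the end-vertices are not internal). A $u$-$v$ geodesic is a $u$-$v$ path of length $d(u,v)$. A vertex-colored graph is strong proper vertex-connected (respectively strong rainbow vertex-connected) if for any two distinct vertices $u,v$ there exists a vertex-proper (respectively vertex-rainbow) $u$-$v$ geodesic. For a connected graph $G$, $spvc(G)$ (respectively $srvc(G)$) is the smallest number of colors required to make $G$ strong proper vertex-connected (respectively strong rainbow vertex-connected). *)

theory Defs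
  imports "Graph_Theory.Graph_Theory"
begin

text \<open>
  A simple undirected graph is represented by its symmetric arc set (the locale \<^locale>\<open>pair_graph\<close>,
  or \<^locale>\<open>graph\<close> for arbitrary arc types); each undirected edge gives two opposite arcs.
  Paths are \<^const>\<open>pre_digraph.apath\<close>, i.e. walks without repeated vertices. The distance
  \<open>d(u,v)\<close> is the shortest-path distance \<^const>\<open>wf_digraph.\<mu>\<close> for the unit weight function.
\<close>

definition geodesic :: "('a, 'b) pre_digraph \<Rightarrow> 'a \<Rightarrow> 'b list \<Rightarrow> 'a \<Rightarrow> bool" where
  "geodesic G u p v \<longleftrightarrow>
     pre_digraph.apath G u p v \<and> ereal (real (length p)) = wf_digraph.\<mu> G (\<lambda>_. 1) u v"

text \<open>
  The list \<^const>\<open>pre_digraph.inner_verts\<close> enumerates the internal vertices in path order, so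
  \<^const>\<open>distinct_adj\<close> compares exactly the colors of consecutive internal vertices.
\<close>

definition vertex_proper :: "('a, 'b) pre_digraph \<Rightarrow> ('a \<Rightarrow> 'c) \<Rightarrow> 'b list \<Rightarrow> bool" where
  "vertex_proper G c p \<longleftrightarrow> distinct_adj (map c (pre_digraph.inner_verts G p))"

definition vertex_rainbow :: "('a, 'b) pre_digraph \<Rightarrow> ('a \<Rightarrow> 'c) \<Rightarrow> 'b list \<Rightarrow> bool" where
  "vertex_rainbow G c p \<longleftrightarrow> distinct (map c (pre_digraph.inner_verts G p))"

definition strong_proper_vertex_connected :: "('a, 'b) pre_digraph \<Rightarrow> ('a \<Rightarrow> 'c) \<Rightarrow> bool" where
  "strong_proper_vertex_connected G c \<longleftrightarrow>
     (\<forall>u \<in> verts G. \<forall>v \<in> verts G. u \<noteq> v \<longrightarrow> (\<exists>p. geodesic G u p v \<and> vertex_proper G c p))"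

definition strong_rainbow_vertex_connected :: "('a, 'b) pre_digraph \<Rightarrow> ('a \<Rightarrow> 'c) \<Rightarrow> bool" where
  "strong_rainbow_vertex_connected G c \<longleftrightarrow>
     (\<forall>u \<in> verts G. \<forall>v \<in> verts G. u \<noteq> v \<longrightarrow> (\<exists>p. geodesic G u p v \<and> vertex_rainbow G c p))"

text \<open>
  The available colors are the numbers below \<open>k\<close>. For a finite connected graph the minima below
  exist, since an injective coloring makes every geodesic vertex-rainbow and vertex-proper.
\<close>

definition spvc :: "('a, 'b) pre_digraph \<Rightarrow> nat" where
  "spvc G = (LEAST k. \<exists>c :: 'a \<Rightarrow> nat. c ` verts G \<subseteq> {..<k} \<and> strong_proper_vertex_connected G c)"

definition srvc :: "('a, 'b) pre_digraph \<Rightarrow> nat" where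
  "srvc G = (LEAST k. \<exists>c :: 'a \<Rightarrow> nat. c ` verts G \<subseteq> {..<k} \<and> strong_rainbow_vertex_connected G c)"

end

theory Submission
  imports Defs
begin

text \<open>
  Attach a pendant vertex to every vertex of a connected graph \<open>H\<close> with \<open>b\<close> vertices. A path between
  two pendant vertices has both of their neighbours as internal vertices, so \<open>srvc\<close> of the result
  is \<open>b\<close>; when these neighbours are adjacent, they are the only internal vertices of a geodesic.
  Since internal vertices always belong to \<open>H\<close>, a proper coloring of \<open>H\<close> makes every path
  vertex-proper, so \<open>spvc\<close> lies between the clique number and the chromatic number of \<open>H\<close>. Both are
  \<open>a\<close> for the Turan graph, where \<open>i\<close> and \<open>j\<close> are adjacent iff they differ modulo \<open>a\<close>.
\<close>

section \<open>Geodesics and internal vertices in general digraphs\<close>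

lemma (in wf_digraph) awalk_cost_unit: "awalk_cost (\<lambda>_. 1) p = real (length p)"
  by (induct p) auto

lemma (in fin_digraph) geodesic_exists:
  assumes "u \<rightarrow>\<^sup>* v"
  shows "\<exists>p. geodesic G u p v"
  using min_cost_awalk[OF assms, of "\<lambda>_. 1"]
  by (auto simp: geodesic_def awalk_cost_unit)

lemma (in wf_digraph) geodesic_length_le:
  assumes "geodesic G u p v" "awalk u q v"
  shows "length p \<le> length q"
proof -
  have "ereal (real (length p)) \<le> ereal (real (length q))"
    using min_cost_le_walk_cost[OF assms(2), of "\<lambda>_. 1"] assms(1)
    by (simp add: geodesic_def awalk_cost_unit)
  then show ?thesis by simp
qed

lemma (in wf_digraph) awalk_successively_dominates:
  assumes "awalk u p v"
  shows "successively (dominates G) (awalk_verts u p)"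
  using assms
proof (induct p arbitrary: u)
  case (Cons e p)
  then show ?case
    by (cases p) (auto simp: awalk_Cons_iff dest: in_arcs_imp_in_arcs_ends)
qed simp

lemma (in wf_digraph) successively_inner_verts:
  assumes "awalk u p v"
  shows "successively (dominates G) (inner_verts p)"
proof -
  \<comment> \<open>The internal vertices are the walk's vertex list without its two ends, and a
    contiguous piece of a list keeps its consecutive pairs.\<close>
  have *: "successively P (butlast (tl xs))" if "successively P xs" for P and xs :: "'a list"
  proof (cases "tl xs" rule: rev_cases)
    case (snoc ys y)
    with that show ?thesis
      by (cases xs) (auto simp: successively_Cons successively_append_iff)
  qed simp
  show ?thesis
    unfolding inner_verts_conv[of p u] using awalk_successively_dominates[OF assms] by (rule *)
qed

text \<open>The predecessor and the successor on the path serve as witnesses; they differ because a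
  path repeats no vertex. This later keeps vertices of degree one out of the interior.\<close>

lemma (in wf_digraph) inner_vert_two_neighbours:
  assumes "apath u p v" "x \<in> set (inner_verts p)"
  shows "\<exists>y z. y \<noteq> z \<and> y \<rightarrow> x \<and> x \<rightarrow> z"
  using assms
proof (induct p arbitrary: u)
  case (Cons e p)
  then show ?case
  proof (cases p)
    case (Cons e' q)
    with Cons.prems have ap: "apath (head G e) p v" and arcs: "e \<in> arcs G" "e' \<in> arcs G"
      and eq: "tail G e' = head G e"
      and "tail G e \<notin> set (awalk_verts (head G e) p)"
      and "x = head G e \<or> x \<in> set (inner_verts p)"
      by (auto simp: apath_Cons_iff inner_verts_def)
    \<comment> \<open>If \<open>x\<close> is the head of \<open>e\<close>, this is its successor; it
      lies on the remaining path, which avoids the tail of \<open>e\<close>.\<close>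
    moreover have "head G e' \<in> set (awalk_verts (head G e) p)"
      using ap Cons by (auto simp: apath_Cons_iff dest: hd_in_awalk_verts(2))
    ultimately show ?thesis
      using Cons.hyps[OF ap] by (metis in_arcs_imp_in_arcs_ends)
  qed simp
qed simp

text \<open>The first arc can only lead to \<open>i\<close> and the last can only come from
  \<open>j\<close>. The inequalities ensure that neither is an end of the path.\<close>

lemma (in wf_digraph) pendant_ends_inner_verts:
  assumes p: "apath u p v" and "u \<noteq> v"
    and u: "\<And>x. u \<rightarrow> x \<Longrightarrow> x = i" and v: "\<And>x. x \<rightarrow> v \<Longrightarrow> x = j"
    and "i \<noteq> v" "j \<noteq> u" "u \<noteq> i" "v \<noteq> j"
  shows "i \<in> set (inner_verts p)" "j \<in> set (inner_verts p)"
proof -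
  have "p \<noteq> []" using p \<open>u \<noteq> v\<close> by (auto simp: apath_Nil_iff)
  then have e: "hd p \<in> arcs G" "tail G (hd p) = u" "last p \<in> arcs G" "head G (last p) = v"
    using p awlast_of_awalk[of u p v] by (auto simp: apath_def awalk_def awalk_verts_conv cas_simp)
  then have "head G (hd p) = i" "tail G (last p) = j"
    using u v by (metis in_arcs_imp_in_arcs_ends)+
  then have "i \<in> set (awalk_verts u p)" "j \<in> set (awalk_verts u p)"
    using awalk_verts_arc1[of "last p" p u] awalk_verts_arc2[of u p v "hd p"] p \<open>p \<noteq> []\<close>
    by (auto simp: apath_def)
  then show "i \<in> set (inner_verts p)" "j \<in> set (inner_verts p)"
    using assms by (auto simp: set_inner_verts[OF p])
qed

text \<open>Vertices below \<open>b\<close> form the core, with residue classes modulo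
  \<open>a\<close> as its parts; \<open>i + b\<close> is the pendant vertex at \<open>i\<close>. The
  core relation is already symmetric, whereas pendant edges are listed in both directions.\<close>

definition turan_corona :: "nat \<Rightarrow> nat \<Rightarrow> nat pair_pre_digraph" where
  "turan_corona a b = \<lparr>pverts = {..<2 * b},
     parcs = {(i, j). i < b \<and> j < b \<and> i mod a \<noteq> j mod a}
       \<union> (\<lambda>i. (i, i + b)) ` {..<b} \<union> (\<lambda>i. (i + b, i)) ` {..<b}\<rparr>"

section \<open>Adjacency and connectedness of the graph\<close>

locale turan_corona_params =
  fixes a b :: nat
  assumes two_le_a: "2 \<le> a" and a_le_b: "a \<le> b"
begin

abbreviation "G \<equiv> turan_corona a b"

sublocale pair_graph G
proof
  have *: "parcs G \<subseteq> pverts G \<times> pverts G"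
    using two_le_a a_le_b by (auto simp: turan_corona_def)
  show "finite (pverts G)" by (simp add: turan_corona_def)
  with * show "finite (parcs G)" by (meson finite_SigmaI finite_subset)
  fix e assume e: "e \<in> parcs G"
  with * show "fst e \<in> pverts G" "snd e \<in> pverts G" by auto
  show "fst e \<noteq> snd e" using e two_le_a a_le_b by (auto simp: turan_corona_def)
next
  show "symmetric (with_proj G)"
    by (auto simp: symmetric_def sym_def turan_corona_def)
qed

lemma arc_core: "i < b \<Longrightarrow> j < b \<Longrightarrow> (i, j) \<in> parcs G \<longleftrightarrow> i mod a \<noteq> j mod a"
  by (auto simp: turan_corona_def)

lemma arc_pendant: "(i + b, x) \<in> parcs G \<longleftrightarrow> i < b \<and> x = i" "(x, i + b) \<in> parcs G \<longleftrightarrow> i < b \<and> x = i"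
  by (auto simp: turan_corona_def)

lemma pverts_cases:
  assumes "x \<in> pverts G"
  obtains "x < b" | i where "i < b" "x = i + b"
proof (cases "x < b")
  case False
  with assms show ?thesis using that(2)[of "x - b"] by (auto simp: turan_corona_def)
qed (use that in auto)

lemma reachable_0:
  assumes "x \<in> pverts G"
  shows "x \<rightarrow>\<^sup>*\<^bsub>with_proj G\<^esub> 0"
proof -
  have core: "i \<rightarrow>\<^sup>*\<^bsub>with_proj G\<^esub> 0" if "i < b" for i
  proof (cases "i mod a = 0")
    case True
    \<comment> \<open>A vertex in the class of 0 is not adjacent to 0, so the route goes through 1,
      which lies in another class because \<open>a\<close> is at least 2.\<close>
    then have "(i, 1) \<in> parcs G" "(1, 0) \<in> parcs G"
      using that two_le_a a_le_b by (auto simp: arc_core)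
    then show ?thesis
      by (metis with_proj_simps(3) reachable_adjI adj_reachable_trans)
  next
    case False
    then have "(i, 0) \<in> parcs G"
      using that two_le_a a_le_b by (auto simp: arc_core)
    then show ?thesis
      by auto
  qed
  from assms show ?thesis
  proof (cases rule: pverts_cases)
    case (2 i)
    then have "(x, i) \<in> parcs G" by (simp add: arc_pendant)
    with core[OF 2(1)] show ?thesis by (metis with_proj_simps(3) adj_reachable_trans)
  qed (use core in auto)
qed

lemma all_reachable:
  assumes "x \<in> pverts G" "y \<in> pverts G"
  shows "x \<rightarrow>\<^sup>*\<^bsub>with_proj G\<^esub> y"
  using reachable_0[OF assms(1)] reachable_0[OF assms(2)]
  by (meson reachable_trans symmetric_reachable')

lemma connected: "Digraph_Component.connected (with_proj G)"
proof -
  have "pverts G \<noteq> {}" using two_le_a a_le_b by (auto simp: turan_corona_def lessThan_empty_iff)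
  then show ?thesis
    using all_reachable
    by (auto simp: connected_def strongly_connected_def intro: reachable_mk_symmetricI)
qed

text \<open>A pendant vertex has only one neighbour, but an internal vertex needs two.\<close>

lemma inner_verts_core:
  assumes "apath u p v" "x \<in> set (inner_verts p)"
  shows "x < b"
proof -
  obtain y z where yz: "y \<noteq> z" "(y, x) \<in> parcs G" "(x, z) \<in> parcs G"
    using inner_vert_two_neighbours[OF assms] by auto
  then have "x \<in> pverts G" by (metis in_arcsD1)
  then show ?thesis
    by (cases rule: pverts_cases) (use yz in \<open>auto simp: arc_pendant\<close>)
qed

section \<open>Necessary and sufficient conditions on the colorings\<close>

lemma pendant_path_inner_verts:
  assumes "apath (i + b) p (j + b)" "i < b" "j < b" "i \<noteq> j"
  shows "i \<in> set (inner_verts p)" "j \<in> set (inner_verts p)"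
  using assms pendant_ends_inner_verts[OF assms(1), of i j] by (auto simp: arc_pendant)

lemma pendant_in_pverts: "i < b \<Longrightarrow> i + b \<in> pverts G"
  by (simp add: turan_corona_def)

lemma strong_rainbow_inj_on:
  assumes "strong_rainbow_vertex_connected (with_proj G) c"
  shows "inj_on c {..<b}"
proof (rule inj_onI, rule ccontr)
  fix i j assume ij: "i \<in> {..<b}" "j \<in> {..<b}" "c i = c j" "i \<noteq> j"
  obtain p where p: "apath (i + b) p (j + b)" "distinct (map c (inner_verts p))"
    using assms ij pendant_in_pverts[of i] pendant_in_pverts[of j]
    unfolding strong_rainbow_vertex_connected_def geodesic_def vertex_rainbow_def
    by (metis add_right_cancel lessThan_iff with_proj_simps(1))
  from pendant_path_inner_verts[OF p(1)] p(2) ij show False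
    by (auto simp: distinct_map dest: inj_onD)
qed

lemma strong_proper_inj_on:
  assumes "strong_proper_vertex_connected (with_proj G) c"
  shows "inj_on c {..<a}"
proof (rule inj_onI, rule ccontr)
  fix i j assume ij: "i \<in> {..<a}" "j \<in> {..<a}" "c i = c j" "i \<noteq> j"
  then have lt: "i < b" "j < b" using a_le_b by auto
  obtain p where p: "geodesic (with_proj G) (i + b) p (j + b)" "distinct_adj (map c (inner_verts p))"
    using assms ij(4) pendant_in_pverts[OF lt(1)] pendant_in_pverts[OF lt(2)]
    unfolding strong_proper_vertex_connected_def vertex_proper_def
    by (metis add_right_cancel with_proj_simps(1))
  \<comment> \<open>Numbers below \<open>a\<close> are their own residues, so \<open>i\<close> and
    \<open>j\<close> are adjacent. This walk leaves a geodesic room for at most two internal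
    vertices, which must then be \<open>i\<close> and \<open>j\<close>, next to each other.\<close>
  have "awalk (i + b) [(i + b, i), (i, j), (j, j + b)] (j + b)"
    using lt ij by (auto simp: awalk_def arc_pendant arc_core pendant_in_pverts)
  then have "length p \<le> 3" using geodesic_length_le[OF p(1)] by force
  then have "length (inner_verts p) \<le> 2" by (simp add: inner_verts_def)
  moreover have "i \<in> set (inner_verts p)" "j \<in> set (inner_verts p)"
    using pendant_path_inner_verts p(1) lt ij by (auto simp: geodesic_def)
  ultimately have "inner_verts p = [i, j] \<or> inner_verts p = [j, i]"
    using ij(4) by (cases "inner_verts p" rule: remdups_adj.cases) auto
  with p(2) ij show False by auto
qed

text \<open>Any geodesic works: its internal vertices are distinct and lie in the core, where
  \<open>c\<close> is injective.\<close>

lemma strong_rainbow_if_inj_on: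
  assumes "inj_on c {..<b}"
  shows "strong_rainbow_vertex_connected (with_proj G) c"
  unfolding strong_rainbow_vertex_connected_def
proof (intro ballI impI)
  fix u v assume "u \<in> verts (with_proj G)" "v \<in> verts (with_proj G)" "u \<noteq> v"
  then obtain p where p: "geodesic (with_proj G) u p v"
    using geodesic_exists[OF all_reachable] by auto
  then have ap: "apath u p v" by (simp add: geodesic_def)
  then have "distinct (inner_verts p)"
    unfolding inner_verts_conv[of p u] by (auto simp: apath_def distinct_tl distinct_butlast)
  moreover have "inj_on c (set (inner_verts p))"
    using inner_verts_core[OF ap] by (intro inj_on_subset[OF assms]) auto
  ultimately show "\<exists>p. geodesic (with_proj G) u p v \<and> vertex_rainbow (with_proj G) c p"
    using p by (auto simp: vertex_rainbow_def distinct_map)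
qed

text \<open>Consecutive internal vertices are joined by a core edge, so any geodesic works, whatever
  the colors of the pendant vertices.\<close>

lemma strong_proper_if_proper:
  assumes "\<And>i j. i < b \<Longrightarrow> j < b \<Longrightarrow> i mod a \<noteq> j mod a \<Longrightarrow> c i \<noteq> c j"
  shows "strong_proper_vertex_connected (with_proj G) c"
  unfolding strong_proper_vertex_connected_def
proof (intro ballI impI)
  fix u v assume "u \<in> verts (with_proj G)" "v \<in> verts (with_proj G)" "u \<noteq> v"
  then obtain p where p: "geodesic (with_proj G) u p v"
    using geodesic_exists[OF all_reachable] by auto
  then have ap: "apath u p v" by (simp add: geodesic_def)
  have "successively (\<lambda>x y. (x, y) \<in> parcs G) (inner_verts p)"
    using successively_inner_verts awalkI_apath[OF ap] by auto
  then have "successively (\<lambda>x y. c x \<noteq> c y) (inner_verts p)"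
    by (rule successively_mono) (use inner_verts_core[OF ap] assms arc_core in blast)
  then show "\<exists>p. geodesic (with_proj G) u p v \<and> vertex_proper (with_proj G) c p"
    using p by (auto simp: vertex_proper_def distinct_adj_def successively_map)
qed

section \<open>The exact values of both parameters\<close>

lemma srvc_eq: "srvc (with_proj G) = b"
  unfolding srvc_def
proof (rule Least_equality)
  \<comment> \<open>Pendant vertices are never internal, so they may reuse color 0, which is
    available since \<open>b\<close> is positive.\<close>
  let ?c = "\<lambda>x. if x < b then x else 0"
  have "?c ` verts (with_proj G) \<subseteq> {..<b}" using two_le_a a_le_b by auto
  moreover have "strong_rainbow_vertex_connected (with_proj G) ?c"
    by (rule strong_rainbow_if_inj_on) (auto simp: inj_on_def)
  ultimately show "\<exists>c. c ` verts (with_proj G) \<subseteq> {..<b} \<and> strong_rainbow_vertex_connected (with_proj G) c"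
    by blast
next
  fix k :: nat
  assume "\<exists>c :: nat \<Rightarrow> nat. c ` verts (with_proj G) \<subseteq> {..<k} \<and> strong_rainbow_vertex_connected (with_proj G) c"
  then obtain c where c: "c ` pverts G \<subseteq> {..<k}" "inj_on c {..<b}"
    using strong_rainbow_inj_on by auto
  moreover have "{..<b} \<subseteq> pverts G" by (auto simp: turan_corona_def)
  ultimately have "c ` {..<b} \<subseteq> {..<k}" by blast
  with c(2) show "b \<le> k" using card_inj_on_le[of c "{..<b}" "{..<k}"] by simp
qed

lemma spvc_eq: "spvc (with_proj G) = a"
  unfolding spvc_def
proof (rule Least_equality)
  let ?c = "\<lambda>x. x mod a"
  have "?c ` verts (with_proj G) \<subseteq> {..<a}" using two_le_a by auto
  moreover have "strong_proper_vertex_connected (with_proj G) ?c"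
    by (rule strong_proper_if_proper)
  ultimately show "\<exists>c. c ` verts (with_proj G) \<subseteq> {..<a} \<and> strong_proper_vertex_connected (with_proj G) c"
    by blast
next
  fix k :: nat
  assume "\<exists>c :: nat \<Rightarrow> nat. c ` verts (with_proj G) \<subseteq> {..<k} \<and> strong_proper_vertex_connected (with_proj G) c"
  then obtain c where c: "c ` pverts G \<subseteq> {..<k}" "inj_on c {..<a}"
    using strong_proper_inj_on by auto
  moreover have "{..<a} \<subseteq> pverts G" using a_le_b by (auto simp: turan_corona_def)
  ultimately have "c ` {..<a} \<subseteq> {..<k}" by blast
  with c(2) show "a \<le> k" using card_inj_on_le[of c "{..<a}" "{..<k}"] by simp
qed

end

theorem theorem8:
  fixes a b :: nat
  assumes "2 \<le> a" and "a \<le> b"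
  shows "\<exists>G :: nat pair_pre_digraph.
           pair_graph G \<and> Digraph_Component.connected (with_proj G) \<and>
           spvc (with_proj G) = a \<and> srvc (with_proj G) = b"
proof -
  interpret turan_corona_params a b
    using assms by unfold_locales
  show ?thesis
    using pair_graph connected spvc_eq srvc_eq by blast
qed

end
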